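(* Let $0<q<1$, and let $\mathrm{T}(z;q^2)$ denote either the function $\cos(z;q^2)$ or the function $\sin(z;q^2)$ defined by $$\cos(z;q^2):=\sum_{k=0}^\infty\frac{(-1)^k\,q^{k(k+1)}\,z^{2k}}{(q;q)_{2k}},\qquad \sin(z;q^2):=\sum_{k=0}^\infty\frac{(-1)^k\,q^{k(k+1)}\,z^{2k+1}}{(q;q)_{2k+1}}.$$ Let $\mathcal{H}$ be the Hilbert space of functions $f:\{q^k: k\in\mathbb{Z}\}\to\mathbb{C}$ with $\sum_{k=-\infty}^\infty q^k|f(q^k)|^2<\infty$. Then for each of the two choices of $\mathrm{T}$ the following transform pair holds: for $f,g\in\mathcal{H}$, the relation $$g(q^n)=\frac{(q;q^2)_\infty}{(q^2;q^2)_\infty}\sum_{k=-\infty}^\infty q^k\,\mathrm{T}(q^{k+n};q^2)\,f(q^k)\qquad(n\in\mathbb{Z})$$ is equivalent to $$f(q^k)=\frac{(q;q^2)_\infty}{(q^2;q^2)_\infty}\sum_{n=-\infty}^\infty q^n\,\mathrm{T}(q^{k+n};q^2)\,g(q^n)\qquad(k\in\mathbb{Z}),$$ and the transformations $f\mapsto g$ and $g\mapsto f$ so defined establish mutually inverse isometries of $\mathcal{H}$ onto itself: $$\sum_{k=-\infty}^\infty q^k\,|f(q^k)|^2=\sum_{n=-\infty}^\infty q^n\,|g(q^n)|^2 .$$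
   Context: For $0<p<1$ and $a\in\mathbb{C}$: $(a;p)_0:=1$, $(a;p)_k:=\prod_{j=0}^{k-1}(1-ap^j)$, $(a;p)_\infty:=\lim_{k\to\infty}(a;p)_k$. The same function $\mathrm{T}$ (both cosine or both sine) is used in both formulas of the pair. *)

theory Defs
  imports "HOL-Analysis.Analysis"
begin

definition qpoch :: "complex \<Rightarrow> real \<Rightarrow> nat \<Rightarrow> complex" where
  "qpoch a p k = (\<Prod>j<k. 1 - a * of_real p ^ j)"

definition qpoch_inf :: "complex \<Rightarrow> real \<Rightarrow> complex" where
  "qpoch_inf a p = lim (\<lambda>k. qpoch a p k)"

text \<open>The functions written \<open>cos(z;q\<^sup>2)\<close> and \<open>sin(z;q\<^sup>2)\<close>: the parameter below is \<open>q\<close>, not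
  the base \<open>q\<^sup>2\<close>.\<close>

definition qcos :: "real \<Rightarrow> complex \<Rightarrow> complex" where
  "qcos q z = (\<Sum>k. (-1) ^ k * of_real q ^ (k * (k + 1)) * z ^ (2 * k)
                       / qpoch (of_real q) q (2 * k))"

definition qsin :: "real \<Rightarrow> complex \<Rightarrow> complex" where
  "qsin q z = (\<Sum>k. (-1) ^ k * of_real q ^ (k * (k + 1)) * z ^ (2 * k + 1)
                       / qpoch (of_real q) q (2 * k + 1))"

definition qlattice :: "real \<Rightarrow> real set" where
  "qlattice q = range (\<lambda>k::int. q powi k)"

text \<open>Functions on the lattice are represented by functions on \<open>\<real>\<close> that vanish off the lattice,
  so that equality and the pointwise vector space operations agree with those on the lattice.\<close>

definition qH :: "real \<Rightarrow> (real \<Rightarrow> complex) set" where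
  "qH q = {f. (\<forall>x. x \<notin> qlattice q \<longrightarrow> f x = 0) \<and>
              (\<lambda>k::int. q powi k * (cmod (f (q powi k)))\<^sup>2) summable_on UNIV}"

definition qH_norm :: "real \<Rightarrow> (real \<Rightarrow> complex) \<Rightarrow> real" where
  "qH_norm q f = sqrt (\<Sum>\<^sub>\<infinity>k::int. q powi k * (cmod (f (q powi k)))\<^sup>2)"

definition qH_isometry_onto :: "real \<Rightarrow> ((real \<Rightarrow> complex) \<Rightarrow> real \<Rightarrow> complex) \<Rightarrow> bool" where
  "qH_isometry_onto q F \<longleftrightarrow>
     F ` qH q = qH q \<and>
     (\<forall>f\<in>qH q. \<forall>g\<in>qH q. F (\<lambda>x. f x + g x) = (\<lambda>x. F f x + F g x)) \<and>
     (\<forall>c. \<forall>f\<in>qH q. F (\<lambda>x. c * f x) = (\<lambda>x. c * F f x)) \<and>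
     (\<forall>f\<in>qH q. qH_norm q (F f) = qH_norm q f)"

text \<open>The kernel \<open>T(q\<^bsup>k+n\<^esup>)\<close> is symmetric in \<open>k\<close> and \<open>n\<close>, so both transformations of the pair are
  given by this one formula. The exponent of a lattice point \<open>x = q\<^bsup>n\<^esup>\<close> need not be named, because
  \<open>q\<^bsup>k+n\<^esup> = q\<^bsup>k\<^esup> x\<close>.\<close>

definition qtransform ::
  "real \<Rightarrow> (complex \<Rightarrow> complex) \<Rightarrow> (real \<Rightarrow> complex) \<Rightarrow> real \<Rightarrow> complex" where
  "qtransform q T f x =
     (if x \<in> qlattice q
      then qpoch_inf (of_real q) (q\<^sup>2) / qpoch_inf (of_real (q\<^sup>2)) (q\<^sup>2) *
           (\<Sum>\<^sub>\<infinity>k::int. of_real (q powi k) * T (of_real (q powi k * x)) * f (q powi k))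
      else 0)"

lemma qtransform_powi:
  assumes "0 < q"
  shows "qtransform q T f (q powi n) =
    qpoch_inf (of_real q) (q\<^sup>2) / qpoch_inf (of_real (q\<^sup>2)) (q\<^sup>2) *
    (\<Sum>\<^sub>\<infinity>k::int. of_real (q powi k) * T (of_real (q powi (k + n))) * f (q powi k))"
  using assms by (simp add: qtransform_def qlattice_def power_int_add)

end

theory Submission
  imports Defs
begin

text \<open>Put \<open>p = q\<^sup>2\<close> and \<open>C = (q;p)\<^sub>\<infinity> / (p;p)\<^sub>\<infinity>\<close>. After rescaling by \<open>q\<^bsup>k/2\<^esup>\<close> the transform
  becomes the Hankel operator on \<open>\<ell>\<^sup>2(\<int>)\<close> with kernel \<open>\<phi>(k + n)\<close>, \<open>\<phi> k = C q\<^bsup>k/2\<^esup> T(q\<^sup>k)\<close>. The symmetry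
  in \<open>w\<close> and \<open>z\<close> of \<open>(w;p)\<^sub>\<infinity> \<^sub>1\<phi>\<^sub>1(0; w; p, z)\<close> shows that \<open>\<phi>\<close> has the absolutely convergent
  generating function \<open>(r/s;p)\<^sub>\<infinity> / (r s;p)\<^sub>\<infinity>\<close> in \<open>s\<close>, with \<open>r = q\<^bsup>1/2\<^esup>\<close> for the cosine and
  \<open>r = q\<^bsup>3/2\<^esup>\<close> for the sine. It is unimodular on the unit circle, so the operator is unitary, and
  as its kernel is real and symmetric it is an involution.\<close>

section \<open>Absolutely summable kernels on the integers\<close>

text \<open>Two constants of the library share this notation; it is kept for the one of \<open>Infinite_Sum\<close>.\<close>

no_notation Infinite_Set_Sum.abs_summable_on (infix "abs'_summable'_on" 50)

lemma abs_summable_on_times: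
  fixes f :: "'a \<Rightarrow> 'c::{real_normed_div_algebra}" and g :: "'b \<Rightarrow> 'c"
  assumes "f abs_summable_on A" "g abs_summable_on B"
  shows "(\<lambda>(x, y). f x * g y) abs_summable_on (A \<times> B)"
  unfolding Infinite_Sum.abs_summable_on_Sigma_iff
  using assms by (auto simp: norm_mult infsum_cmult_right' abs_mult
      intro!: summable_on_cmult_right summable_on_cmult_left)

lemma abs_summable_on_times3:
  fixes f :: "'a \<Rightarrow> 'd::real_normed_div_algebra" and g :: "'b \<Rightarrow> 'd" and h :: "'c \<Rightarrow> 'd"
  assumes "f abs_summable_on UNIV" "g abs_summable_on UNIV" "h abs_summable_on UNIV"
  shows "(\<lambda>(x, y, z). f x * g y * h z) abs_summable_on UNIV"
  using abs_summable_on_times[OF assms(1) abs_summable_on_times[OF assms(2,3)]]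
  by (simp add: case_prod_unfold mult.assoc)

lemma infsum_times:
  fixes f :: "'a \<Rightarrow> 'c::{real_normed_field,banach}" and g :: "'b \<Rightarrow> 'c"
  assumes "f abs_summable_on A" "g abs_summable_on B"
  shows "infsum (\<lambda>(x, y). f x * g y) (A \<times> B) = infsum f A * infsum g B"
proof -
  have "infsum (\<lambda>(x, y). f x * g y) (A \<times> B) = (\<Sum>\<^sub>\<infinity>x\<in>A. \<Sum>\<^sub>\<infinity>y\<in>B. f x * g y)"
    by (rule infsum_Sigma'_banach[symmetric])
      (use abs_summable_summable[OF abs_summable_on_times[OF assms]] in simp)
  also have "\<dots> = infsum f A * infsum g B"
    by (simp add: infsum_cmult_right' infsum_cmult_left')
  finally show ?thesis .
qed

lemma abs_summable_on_reindex_bij: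
  fixes f :: "'b \<Rightarrow> 'c::real_normed_vector"
  assumes "bij_betw g A B" "f abs_summable_on B"
  shows "(\<lambda>x. f (g x)) abs_summable_on A"
  using summable_on_reindex_bij_betw[OF assms(1), of "\<lambda>x. norm (f x)"] assms(2) by simp

lemma infsum_of_real_complex: "(\<Sum>\<^sub>\<infinity>x\<in>A. complex_of_real (f x)) = of_real (infsum f A)"
proof (cases "f summable_on A")
  case True
  then show ?thesis by (intro infsumI has_sum_of_real has_sum_infsum)
next
  case False
  \<comment> \<open>Real parts of a summable complex family are summable, so both sums fail to exist
    together and both take the default value 0.\<close>
  then have "\<not> (\<lambda>x. complex_of_real (f x)) summable_on A"
    using summable_on_bounded_linear[OF bounded_linear_Re, of "\<lambda>x. complex_of_real (f x)" A] by auto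
  with False show ?thesis by (simp add: infsum_not_exists)
qed

lemma abs_summable_on_shift_int:
  fixes f :: "int \<Rightarrow> 'a::real_normed_vector"
  assumes "f abs_summable_on UNIV"
  shows "(\<lambda>k. f (k + n)) abs_summable_on UNIV"
  using summable_on_reindex_bij_betw[of "\<lambda>k. k + n" UNIV UNIV "\<lambda>k. norm (f k)"] assms
  by (simp add: bij_betw_def inj_on_def)

lemma infsum_shift_int:
  fixes f :: "int \<Rightarrow> 'a::real_normed_vector"
  shows "(\<Sum>\<^sub>\<infinity>k. f (k + n)) = (\<Sum>\<^sub>\<infinity>k. f k)"
  by (rule infsum_reindex_bij_betw) (simp add: bij_betw_def inj_on_def)

lemma abs_summable_on_bounded:
  assumes "f abs_summable_on (UNIV :: 'a set)"
  obtains M where "0 \<le> M" "\<And>x. norm (f x) \<le> M"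
proof
  show "norm (f x) \<le> (\<Sum>\<^sub>\<infinity>x. norm (f x))" for x
    using finite_sum_le_infsum[OF assms, of "{x}"] by simp
qed (simp add: infsum_nonneg)

lemma abs_summable_on_mult_bounded:
  fixes f g :: "'a \<Rightarrow> 'c::real_normed_div_algebra"
  assumes "f abs_summable_on A" "\<And>x. norm (g x) \<le> M"
  shows "(\<lambda>x. f x * g x) abs_summable_on A"
proof (rule Infinite_Sum.abs_summable_on_comparison_test')
  show "(\<lambda>x. norm (f x) * M) summable_on A"
    using assms(1) by (rule summable_on_cmult_left)
  show "norm (f x * g x) \<le> norm (f x) * M" for x
    by (simp add: norm_mult mult_left_mono assms(2))
qed

section \<open>Correlations of summable sequences on the integers\<close>

definition correlation :: "(int \<Rightarrow> real) \<Rightarrow> (int \<Rightarrow> real) \<Rightarrow> int \<Rightarrow> real" where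
  "correlation a b k = (\<Sum>\<^sub>\<infinity>j. a j * b (k + j))"

text \<open>The shear sending \<open>(k, j)\<close> to \<open>(j, k + j)\<close> is a bijection that
  identifies this family with the product of \<open>a\<close> and \<open>b\<close>.\<close>

lemma correlation_terms_summable:
  fixes a b :: "int \<Rightarrow> real"
  assumes "a abs_summable_on UNIV" "b abs_summable_on UNIV"
  shows "(\<lambda>(k, j). a j * b (k + j)) abs_summable_on UNIV"
proof -
  have "bij_betw (\<lambda>(k, j). (j, k + j)) (UNIV :: (int \<times> int) set) UNIV"
    by (rule bij_betwI[where g = "\<lambda>(j, u). (u - j, j)"]) auto
  from abs_summable_on_reindex_bij[OF this, of "\<lambda>(j, u). a j * b u"] abs_summable_on_times[OF assms]
  show ?thesis by (simp add: case_prod_unfold)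
qed

lemma correlation_abs_summable:
  assumes "a abs_summable_on UNIV" "b abs_summable_on UNIV"
  shows "correlation a b abs_summable_on UNIV"
proof -
  have "(\<lambda>(k, j). a j * b (k + j)) summable_on UNIV \<times> UNIV"
    using abs_summable_summable[OF correlation_terms_summable[OF assms]] by simp
  from summable_on_Sigma_banach[OF this] have "correlation a b summable_on UNIV"
    by (simp add: correlation_def[abs_def])
  then show ?thesis
    by (rule summable_on_iff_abs_summable_on_real[THEN iffD1])
qed

text \<open>On the unit circle the Fourier series of the correlation is that of \<open>b\<close> times the conjugate
  of that of \<open>a\<close>, hence unimodular if the two are inverse to each other. The proof rearranges the
  sum over \<open>k, i, j\<close> of \<open>a j b (k + j) a i b (k + n + i)\<close> by putting \<open>N = k + i + j\<close>.\<close>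

lemma correlation_orthogonal:
  assumes a: "a abs_summable_on UNIV" and b: "b abs_summable_on UNIV"
    and conv: "\<And>n. (\<Sum>\<^sub>\<infinity>j. a j * b (n - j)) = (if n = 0 then 1 else 0)"
  shows "(\<Sum>\<^sub>\<infinity>k. correlation a b k * correlation a b (k + n)) = (if n = 0 then 1 else 0)"
proof -
  obtain M where M: "0 \<le> M" "\<And>x. norm (b x) \<le> M"
    using abs_summable_on_bounded[OF b] by metis
  \<comment> \<open>At \<open>N = k + i + j\<close> one has \<open>N - i = k + j\<close> and
    \<open>N + n - j = k + n + i\<close>: the two \<open>b\<close> factors trade partners, and
    correlations become convolutions.\<close>
  define t where "t = (\<lambda>(N, i, j). (a i * b (N - i)) * (a j * b (N + n - j)))"
  have t_bij: "bij_betw (\<lambda>(k, i, j). (k + i + j, i, j)) (UNIV :: (int \<times> int \<times> int) set) UNIV"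
    by (rule bij_betwI[where g = "\<lambda>(N, i, j). (N - i - j, i, j)"]) auto
  \<comment> \<open>Three of the four factors of \<open>t\<close> form a summable product in
    independent indices; the remaining \<open>b\<close> factor is only bounded by
    \<open>M\<close>.\<close>
  have "(\<lambda>(i, j, u). a i * a j * b u) abs_summable_on UNIV"
    by (intro abs_summable_on_times3 a b)
  moreover have "bij_betw (\<lambda>(N, i, j). (i, j, N - i)) (UNIV :: (int \<times> int \<times> int) set) UNIV"
    by (rule bij_betwI[where g = "\<lambda>(i, j, u). (u + i, i, j)"]) auto
  ultimately have "(\<lambda>(N, i, j). a i * a j * b (N - i)) abs_summable_on UNIV"
    using abs_summable_on_reindex_bij[of "\<lambda>(N, i, j). (i, j, N - i)" UNIV UNIV
        "\<lambda>(i, j, u). a i * a j * b u"]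
    by (simp add: case_prod_unfold)
  then have "(\<lambda>x. (case x of (N, i, j) \<Rightarrow> a i * a j * b (N - i)) *
      (case x of (N, i, j) \<Rightarrow> b (N + n - j))) abs_summable_on UNIV"
    by (rule abs_summable_on_mult_bounded[where M = M]) (use M(2) in \<open>auto split: prod.split\<close>)
  moreover have t_eq: "t = (\<lambda>x. (case x of (N, i, j) \<Rightarrow> a i * a j * b (N - i)) *
      (case x of (N, i, j) \<Rightarrow> b (N + n - j)))"
    unfolding t_def by (rule ext) (simp add: mult_ac split: prod.split)
  ultimately have t_sum: "t abs_summable_on UNIV"
    by (simp only: t_eq)
  have t_reindexed: "t (case x of (k, i, j) \<Rightarrow> (k + i + j, i, j)) =
      (case x of (k, i, j) \<Rightarrow> (a j * b (k + j)) * (a i * b (k + n + i)))" for x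
  proof -
    obtain k i j where x: "x = (k, i, j)" by (cases x)
    have "k + i + j - i = k + j" "k + i + j + n - j = k + n + i" by simp_all
    then show ?thesis
      by (simp add: x t_def add_ac)
  qed
  have t'_sum: "(\<lambda>(k, i, j). (a j * b (k + j)) * (a i * b (k + n + i))) abs_summable_on UNIV"
    using abs_summable_on_reindex_bij[OF t_bij t_sum] unfolding t_reindexed .
  have conv_sum: "(\<lambda>i. a i * b (N - i)) abs_summable_on UNIV" for N
    by (rule abs_summable_on_mult_bounded[OF a, of _ M]) (rule M)
  have corr_sum: "(\<lambda>i. a i * b (N + i)) abs_summable_on UNIV" for N
    by (rule abs_summable_on_mult_bounded[OF a, of _ M]) (rule M)
  have "(\<Sum>\<^sub>\<infinity>k. correlation a b k * correlation a b (k + n)) =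
      (\<Sum>\<^sub>\<infinity>k. \<Sum>\<^sub>\<infinity>(i, j). (a j * b (k + j)) * (a i * b (k + n + i)))"
  proof (rule infsum_cong)
    fix k
    have "correlation a b k * correlation a b (k + n) = correlation a b (k + n) * correlation a b k"
      by (rule mult.commute)
    also have "\<dots> = (\<Sum>\<^sub>\<infinity>(i, j). (a i * b (k + n + i)) * (a j * b (k + j)))"
      using infsum_times[OF corr_sum corr_sum, of "k + n" k] by (simp add: correlation_def)
    finally show "correlation a b k * correlation a b (k + n) =
        (\<Sum>\<^sub>\<infinity>(i, j). (a j * b (k + j)) * (a i * b (k + n + i)))"
      by (simp only: mult.commute)
  qed
  also have "\<dots> = infsum (\<lambda>(k, i, j). (a j * b (k + j)) * (a i * b (k + n + i))) UNIV"
    using infsum_Sigma_banach[of "\<lambda>(k, i, j). (a j * b (k + j)) * (a i * b (k + n + i))" UNIV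
        "\<lambda>_. UNIV"] abs_summable_summable[OF t'_sum] by (simp add: case_prod_unfold)
  also have "\<dots> = infsum t UNIV"
    using infsum_reindex_bij_betw[OF t_bij, of t] unfolding t_reindexed .
  also have "\<dots> = (\<Sum>\<^sub>\<infinity>N. infsum (\<lambda>(i, j). (a i * b (N - i)) * (a j * b (N + n - j))) UNIV)"
    using infsum_Sigma_banach[of t UNIV "\<lambda>_. UNIV"] abs_summable_summable[OF t_sum]
    by (simp add: t_def case_prod_unfold)
  \<comment> \<open>At fixed \<open>N\<close> the sum over \<open>(i, j)\<close> is a product of two
    convolutions, concentrated at \<open>N = 0\<close> and at \<open>N + n = 0\<close>.\<close>
  also have "\<dots> = (\<Sum>\<^sub>\<infinity>N. (if N = 0 then 1 else 0) * (if N + n = 0 then 1 else 0))"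
    using infsum_times[OF conv_sum conv_sum] by (simp add: case_prod_unfold conv)
  also have "\<dots> = (\<Sum>\<^sub>\<infinity>N\<in>{0}. (if N + n = 0 then 1 else 0))"
    by (rule infsum_cong_neutral) auto
  also have "\<dots> = (if n = 0 then 1 else 0)"
    by simp
  finally show ?thesis .
qed

section \<open>Hankel operators with orthonormal rows\<close>

definition hankel :: "(int \<Rightarrow> real) \<Rightarrow> (int \<Rightarrow> complex) \<Rightarrow> int \<Rightarrow> complex" where
  "hankel \<phi> F n = (\<Sum>\<^sub>\<infinity>k. of_real (\<phi> (k + n)) * F k)"

lemma hankel_terms_summable:
  fixes F :: "int \<Rightarrow> complex" and \<phi> :: "int \<Rightarrow> real"
  assumes "\<phi> abs_summable_on UNIV" "\<And>k. norm (F k) \<le> M"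
  shows "(\<lambda>k. of_real (\<phi> (k + n)) * F k) abs_summable_on UNIV"
proof (rule abs_summable_on_mult_bounded[where M = M])
  show "(\<lambda>k. complex_of_real (\<phi> (k + n))) abs_summable_on UNIV"
    using abs_summable_on_shift_int[OF assms(1), of n] by simp
qed (rule assms(2))

text \<open>Translating the summation index by \<open>k\<close> leaves only the lag
  \<open>l - k\<close>: the rows of the Hankel matrix are orthonormal.\<close>

lemma orthogonal_shifts:
  fixes \<phi> :: "int \<Rightarrow> real" and k l :: int
  assumes "\<And>n. (\<Sum>\<^sub>\<infinity>k. \<phi> k * \<phi> (k + n)) = (if n = 0 then 1 else 0 :: real)"
  shows "(\<Sum>\<^sub>\<infinity>n. complex_of_real (\<phi> (k + n)) * of_real (\<phi> (n + l))) = (if k = l then 1 else 0)"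
proof -
  have "(\<Sum>\<^sub>\<infinity>n. \<phi> (k + n) * \<phi> (n + l)) = (\<Sum>\<^sub>\<infinity>n. \<phi> n * \<phi> (n + (l - k)))"
    using infsum_shift_int[of "\<lambda>n. \<phi> n * \<phi> (n + (l - k))" k] by (simp add: add.commute[of k])
  also have "\<dots> = (if k = l then 1 else 0)"
    unfolding assms by simp
  finally have "complex_of_real (\<Sum>\<^sub>\<infinity>n. \<phi> (k + n) * \<phi> (n + l)) = (if k = l then 1 else 0)"
    by simp
  then show ?thesis unfolding infsum_of_real_complex[symmetric] by simp
qed

text \<open>A bounded \<open>F\<close> already allows the interchange of sums, since
  \<open>\<phi> (n + l) * \<phi> (k + n)\<close> is absolutely summable over pairs
  \<open>(n, k)\<close>. The inner sum over \<open>n\<close> is then a Kronecker delta.\<close>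

lemma hankel_hankel:
  assumes \<phi>: "\<phi> abs_summable_on UNIV"
    and orth: "\<And>n. (\<Sum>\<^sub>\<infinity>k. \<phi> k * \<phi> (k + n)) = (if n = 0 then 1 else 0 :: real)"
    and F: "\<And>k. norm (F k) \<le> M"
  shows "hankel \<phi> (hankel \<phi> F) l = F l"
proof -
  have c\<phi>: "(\<lambda>k. complex_of_real (\<phi> k)) abs_summable_on UNIV" using \<phi> by simp
  have bij: "bij_betw (\<lambda>(n, k). (n + l, k + n)) (UNIV :: (int \<times> int) set) UNIV"
    by (rule bij_betwI[where g = "\<lambda>(u, v). (u - l, v - (u - l))"]) auto
  have "(\<lambda>(n, k). complex_of_real (\<phi> (n + l)) * of_real (\<phi> (k + n))) abs_summable_on UNIV"
    using abs_summable_on_reindex_bij[OF bij, of "\<lambda>(u, v). complex_of_real (\<phi> u) * of_real (\<phi> v)"]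
      abs_summable_on_times[OF c\<phi> c\<phi>]
    by (simp add: case_prod_unfold)
  from abs_summable_summable[OF abs_summable_on_mult_bounded[OF this, of "\<lambda>x. F (snd x)" M, OF F]]
  have sum: "(\<lambda>(n, k). complex_of_real (\<phi> (n + l)) * of_real (\<phi> (k + n)) * F k) summable_on UNIV"
    by (simp only: case_prod_unfold)
  have "hankel \<phi> (hankel \<phi> F) l =
      (\<Sum>\<^sub>\<infinity>n. \<Sum>\<^sub>\<infinity>k. complex_of_real (\<phi> (n + l)) * of_real (\<phi> (k + n)) * F k)"
    unfolding hankel_def mult.assoc infsum_cmult_right' by (rule refl)
  also have "\<dots> = (\<Sum>\<^sub>\<infinity>k. \<Sum>\<^sub>\<infinity>n. complex_of_real (\<phi> (n + l)) * of_real (\<phi> (k + n)) * F k)"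
    by (rule infsum_swap_banach) (use sum in simp)
  also have "\<dots> = (\<Sum>\<^sub>\<infinity>k. (if k = l then 1 else 0) * F k)"
    unfolding infsum_cmult_left' mult.commute[of "complex_of_real (\<phi> (_ + l))"]
      orthogonal_shifts[OF orth] by (rule refl)
  also have "\<dots> = (\<Sum>\<^sub>\<infinity>k\<in>{l}. F k)"
    by (rule infsum_cong_neutral) auto
  also have "\<dots> = F l"
    by simp
  finally show ?thesis .
qed

text \<open>The triple sum \<open>t\<close> is evaluated in two orders: summing over
  \<open>(k, l)\<close> first gives the squared norms of the image, and summing over
  \<open>n\<close> first leaves the diagonal \<open>k = l\<close>. The \<open>has_sum\<close> form
  also records that the image is square summable.\<close>

lemma hankel_parseval:
  assumes \<phi>: "\<phi> abs_summable_on UNIV"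
    and orth: "\<And>n. (\<Sum>\<^sub>\<infinity>k. \<phi> k * \<phi> (k + n)) = (if n = 0 then 1 else 0 :: real)"
    and F: "(\<lambda>k. (norm (F k))\<^sup>2) summable_on UNIV"
  shows "((\<lambda>n. (norm (hankel \<phi> F n))\<^sup>2) has_sum (\<Sum>\<^sub>\<infinity>k. (norm (F k))\<^sup>2)) UNIV"
proof -
  define t where "t = (\<lambda>(n, k, l). (of_real (\<phi> (k + n)) * F k) * (of_real (\<phi> (l + n)) * cnj (F l)))"
  obtain M where M: "0 \<le> M" "\<And>k. (norm (F k))\<^sup>2 \<le> M"
    using abs_summable_on_bounded[of "\<lambda>k. (norm (F k))\<^sup>2"] F by auto
  have F_le: "norm (F k) \<le> sqrt M" for k
    using M(2) real_le_rsqrt by blast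
  have sum3: "(\<lambda>(k, u, v). (norm (F k))\<^sup>2 * \<bar>\<phi> u\<bar> * \<bar>\<phi> v\<bar>) summable_on UNIV"
    by (rule abs_summable_summable, rule abs_summable_on_times3) (use F \<phi> in auto)
  have bij1: "bij_betw (\<lambda>(n, k, l). (k, k + n, l + n)) (UNIV :: (int \<times> int \<times> int) set) UNIV"
    by (rule bij_betwI[where g = "\<lambda>(k, u, v). (u - k, k, v - (u - k))"]) auto
  have bij2: "bij_betw (\<lambda>(n, k, l). (l, k + n, l + n)) (UNIV :: (int \<times> int \<times> int) set) UNIV"
    by (rule bij_betwI[where g = "\<lambda>(l, u, v). (v - l, u - (v - l), l)"]) auto
  \<comment> \<open>This family dominates \<open>t\<close>, because
    \<open>|F k| |F l| \<le> |F k|^2 + |F l|^2\<close>. Each of its two summands is a reindexed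
    product of \<open>|F|^2\<close>, \<open>|\<phi>|\<close> and \<open>|\<phi>|\<close>.\<close>
  have "(\<lambda>(n, k, l). (norm (F k))\<^sup>2 * \<bar>\<phi> (k + n)\<bar> * \<bar>\<phi> (l + n)\<bar>
      + (norm (F l))\<^sup>2 * \<bar>\<phi> (k + n)\<bar> * \<bar>\<phi> (l + n)\<bar>) summable_on UNIV"
    using summable_on_add[OF summable_on_reindex_bij_betw[OF bij1, THEN iffD2, OF sum3]
        summable_on_reindex_bij_betw[OF bij2, THEN iffD2, OF sum3]]
    by (simp add: case_prod_unfold)
  then have t_sum: "t abs_summable_on UNIV"
  proof (rule Infinite_Sum.abs_summable_on_comparison_test')
    fix x :: "int \<times> int \<times> int"
    obtain n k l where x: "x = (n, k, l)" by (cases x)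
    have "norm (F k) * norm (F l) \<le> (norm (F k))\<^sup>2 + (norm (F l))\<^sup>2"
    proof -
      have "2 * (norm (F k) * norm (F l)) \<le> (norm (F k))\<^sup>2 + (norm (F l))\<^sup>2"
        using sum_squares_bound[of "norm (F k)" "norm (F l)"] by (simp only: mult.assoc)
      moreover have "0 \<le> norm (F k) * norm (F l)"
        by simp
      ultimately show ?thesis by linarith
    qed
    from mult_right_mono[OF this, of "\<bar>\<phi> (k + n)\<bar> * \<bar>\<phi> (l + n)\<bar>"]
    show "norm (t x) \<le> (case x of (n, k, l) \<Rightarrow> (norm (F k))\<^sup>2 * \<bar>\<phi> (k + n)\<bar> * \<bar>\<phi> (l + n)\<bar>
      + (norm (F l))\<^sup>2 * \<bar>\<phi> (k + n)\<bar> * \<bar>\<phi> (l + n)\<bar>)"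
      by (simp add: x t_def norm_mult algebra_simps)
  qed
  have t_n: "infsum (\<lambda>kl. t (n, kl)) UNIV = of_real ((norm (hankel \<phi> F n))\<^sup>2)" for n
  proof -
    have "infsum (\<lambda>kl. t (n, kl)) UNIV =
        hankel \<phi> F n * (\<Sum>\<^sub>\<infinity>l. complex_of_real (\<phi> (l + n)) * cnj (F l))"
      using infsum_times[OF hankel_terms_summable[OF \<phi> F_le, of n]
          hankel_terms_summable[OF \<phi>, of "\<lambda>k. cnj (F k)" "sqrt M" n]] F_le
      by (simp add: t_def hankel_def case_prod_unfold)
    also have "(\<Sum>\<^sub>\<infinity>l. complex_of_real (\<phi> (l + n)) * cnj (F l)) = cnj (hankel \<phi> F n)"
      unfolding hankel_def by (simp flip: infsum_cnj)
    finally show ?thesis by (simp add: complex_norm_square[symmetric] flip: of_real_power)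
  qed
  have t_sum': "t summable_on UNIV \<times> UNIV"
    using abs_summable_summable[OF t_sum] by simp
  have "infsum t UNIV = (\<Sum>\<^sub>\<infinity>n. \<Sum>\<^sub>\<infinity>kl. t (n, kl))"
    using infsum_Sigma_banach[OF t_sum'] by simp
  also have "\<dots> = (\<Sum>\<^sub>\<infinity>kl. \<Sum>\<^sub>\<infinity>n. t (n, kl))"
    by (rule infsum_swap_banach) (use t_sum' in simp)
  also have "\<dots> = (\<Sum>\<^sub>\<infinity>(k, l). (if k = l then F k * cnj (F l) else 0))"
  proof (rule infsum_cong, clarify)
    fix k l
    have "(\<Sum>\<^sub>\<infinity>n. t (n, k, l)) =
        (\<Sum>\<^sub>\<infinity>n. complex_of_real (\<phi> (k + n)) * of_real (\<phi> (n + l)) * (F k * cnj (F l)))"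
      by (simp add: t_def mult_ac add_ac)
    then show "(\<Sum>\<^sub>\<infinity>n. t (n, k, l)) = (if k = l then F k * cnj (F l) else 0)"
      by (simp add: infsum_cmult_left' orthogonal_shifts[OF orth] del: mult.assoc)
  qed
  also have "\<dots> = infsum (\<lambda>(k, l). F k * cnj (F l)) (range (\<lambda>k. (k, k)))"
    by (rule infsum_cong_neutral) auto
  also have "\<dots> = (\<Sum>\<^sub>\<infinity>k. of_real ((norm (F k))\<^sup>2))"
    by (subst infsum_reindex)
      (auto simp: inj_on_def o_def complex_norm_square[symmetric] simp flip: of_real_power)
  also have "\<dots> = of_real (\<Sum>\<^sub>\<infinity>k. (norm (F k))\<^sup>2)"
    by (rule infsum_of_real_complex)
  finally have "(t has_sum of_real (\<Sum>\<^sub>\<infinity>k. (norm (F k))\<^sup>2)) (UNIV \<times> UNIV)"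
    using has_sum_infsum[OF t_sum'] by simp
  then have "((\<lambda>n. complex_of_real ((norm (hankel \<phi> F n))\<^sup>2)) has_sum
      of_real (\<Sum>\<^sub>\<infinity>k. (norm (F k))\<^sup>2)) UNIV"
  proof (rule has_sum_SigmaD)
    fix n :: int
    have "(\<lambda>kl. t (n, kl)) abs_summable_on UNIV"
      using Infinite_Sum.abs_summable_on_Sigma_iff[of t UNIV "\<lambda>_. UNIV"] t_sum by simp
    then have "(\<lambda>kl. t (n, kl)) summable_on UNIV"
      by (rule abs_summable_summable)
    then show "((\<lambda>kl. t (n, kl)) has_sum complex_of_real ((norm (hankel \<phi> F n))\<^sup>2)) UNIV"
      unfolding t_n[symmetric] by (rule has_sum_infsum)
  qed
  then show ?thesis
    by (simp only: has_sum_of_real_iff)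
qed

section \<open>The \<open>q\<close>-exponential series\<close>

text \<open>The ratio enters through a recurrence instead of a quotient, so that terms may vanish,
  as those of a power series do at 0.\<close>

lemma summable_ratio_limit:
  fixes f \<rho> :: "nat \<Rightarrow> real"
  assumes "\<And>n. f (Suc n) = \<rho> n * f n" "\<rho> \<longlonglongrightarrow> L" "\<bar>L\<bar> < 1"
  shows "summable (\<lambda>n. \<bar>f n\<bar>)"
proof -
  obtain c where c: "\<bar>L\<bar> < c" "c < 1" using dense assms(3) by blast
  have "eventually (\<lambda>n. \<bar>\<rho> n\<bar> < c) sequentially"
    using tendsto_rabs[OF assms(2)] c(1) by (rule order_tendstoD)
  then obtain N where N: "\<And>n. n \<ge> N \<Longrightarrow> \<bar>\<rho> n\<bar> < c"
    by (auto simp: eventually_sequentially)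
  show ?thesis
  proof (rule summable_ratio_test[OF c(2), of N])
    fix n assume "n \<ge> N"
    then show "norm \<bar>f (Suc n)\<bar> \<le> c * norm \<bar>f n\<bar>"
      using mult_right_mono[of "\<bar>\<rho> n\<bar>" c "\<bar>f n\<bar>"] N[of n] by (simp add: assms(1) abs_mult)
  qed
qed

definition poch :: "real \<Rightarrow> real \<Rightarrow> nat \<Rightarrow> real" where
  "poch a p k = (\<Prod>j<k. 1 - a * p ^ j)"

lemma poch_0 [simp]: "poch a p 0 = 1"
  and poch_Suc: "poch a p (Suc k) = poch a p k * (1 - a * p ^ k)"
  by (simp_all add: poch_def)

lemma qpoch_of_real: "qpoch (of_real a) p k = of_real (poch a p k)"
  by (simp add: qpoch_def poch_def)

lemma poch_pos:
  assumes "0 < p" "p < 1" "a < 1"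
  shows "poch a p k > 0"
  unfolding poch_def
proof (rule prod_pos, safe)
  fix j
  have "a * p ^ j < 1"
  proof (cases "a \<le> 0")
    case True
    then have "a * p ^ j \<le> 0" using assms by (simp add: mult_nonpos_nonneg)
    then show ?thesis by simp
  next
    case False
    then have "a * p ^ j \<le> a" using assms by (simp add: mult_left_le power_le_one)
    then show ?thesis using assms by simp
  qed
  then show "0 < 1 - a * p ^ j" by simp
qed

text \<open>This is \<open>(-1)\<^sup>j p\<^bsup>j(j-1)/2\<^esup> / (p;p)\<^sub>j\<close>.\<close>

definition euler_coeff :: "real \<Rightarrow> nat \<Rightarrow> real" where
  "euler_coeff p j = (\<Prod>i<j. - (p ^ i / (1 - p ^ Suc i)))"

lemma euler_coeff_0 [simp]: "euler_coeff p 0 = 1"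
  and euler_coeff_Suc: "euler_coeff p (Suc j) = - (p ^ j / (1 - p ^ Suc j)) * euler_coeff p j"
  by (simp_all add: euler_coeff_def)

text \<open>In base \<open>q^2\<close> the coefficient carries \<open>q^(j(j-1))\<close>; the factor
  \<open>q^(2j)\<close> raises this to the \<open>q^(j(j+1))\<close> of the cosine and sine
  series.\<close>

lemma euler_coeff_closed: "euler_coeff (q\<^sup>2) j * q ^ (2 * j) = (-1) ^ j * q ^ (j * (j + 1)) / poch (q\<^sup>2) (q\<^sup>2) j"
proof (induction j)
  case (Suc j)
  have "euler_coeff (q\<^sup>2) (Suc j) * q ^ (2 * Suc j) =
      - ((q\<^sup>2) ^ j * q\<^sup>2 / (1 - q\<^sup>2 * (q\<^sup>2) ^ j)) * (euler_coeff (q\<^sup>2) j * q ^ (2 * j))"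
    by (simp add: euler_coeff_Suc power_add power2_eq_square)
  also have "\<dots> = (-1) ^ Suc j * (q ^ (j * (j + 1)) * ((q\<^sup>2) ^ j * q\<^sup>2)) / poch (q\<^sup>2) (q\<^sup>2) (Suc j)"
    unfolding Suc by (simp add: poch_Suc mult_ac)
  also have "q ^ (j * (j + 1)) * ((q\<^sup>2) ^ j * q\<^sup>2) = q ^ (Suc j * (Suc j + 1))"
    unfolding power_mult[symmetric] power_add[symmetric]
    by (rule arg_cong[where f = "\<lambda>n. q ^ n"]) (simp add: algebra_simps)
  finally show ?case .
qed simp

context
  fixes p :: real
  assumes p: "0 < p" "p < 1"
begin

lemma power_Suc_neq_1: "p ^ Suc n \<noteq> 1" "p * p ^ n \<noteq> 1"
  using power_Suc_less_one[OF p(1), of n] p by auto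

lemma power_tendsto_0: "(\<lambda>n. p ^ n) \<longlonglongrightarrow> 0"
  by (rule LIMSEQ_realpow_zero) (use p in auto)

lemma euler_summable: "summable (\<lambda>j. \<bar>euler_coeff p j * x ^ j\<bar>)"
proof (rule summable_ratio_limit)
  show "euler_coeff p (Suc n) * x ^ Suc n = - (p ^ n / (1 - p ^ Suc n)) * x * (euler_coeff p n * x ^ n)" for n
    by (simp add: euler_coeff_Suc)
  show "(\<lambda>n. - (p ^ n / (1 - p ^ Suc n)) * x) \<longlonglongrightarrow> - (0 / (1 - 0)) * x"
    by (intro tendsto_intros power_tendsto_0 LIMSEQ_Suc[OF power_tendsto_0]) simp
qed simp

lemma inverse_poch_summable:
  assumes "\<bar>x\<bar> < 1"
  shows "summable (\<lambda>j. \<bar>x ^ j / poch p p j\<bar>)"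
proof (rule summable_ratio_limit)
  show "x ^ Suc n / poch p p (Suc n) = x / (1 - p ^ Suc n) * (x ^ n / poch p p n)" for n
    by (simp add: poch_Suc)
  show "(\<lambda>n. x / (1 - p ^ Suc n)) \<longlonglongrightarrow> x / (1 - 0)"
    by (intro tendsto_intros power_tendsto_0 LIMSEQ_Suc[OF power_tendsto_0]) simp
qed (use assms in simp)

text \<open>Euler's series for \<open>(x;p)_inf\<close>. Starting from the series gives continuity
  and double series expansions directly; \<open>qpoch_inf_eq_euler\<close> identifies it with the
  infinite product.\<close>

definition euler :: "real \<Rightarrow> real" where
  "euler x = (\<Sum>j. euler_coeff p j * x ^ j)"

lemma euler_summable': "summable (\<lambda>j. euler_coeff p j * x ^ j)"
  by (rule summable_rabs_cancel) (rule euler_summable)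

text \<open>The recurrence \<open>(1 - p^(j+1)) e_(j+1) = - p^j e_j\<close> of the coefficients
  turns \<open>euler x - euler (p * x)\<close> into \<open>- x * euler (p * x)\<close>.\<close>

lemma euler_step: "euler x = (1 - x) * euler (p * x)"
proof -
  have "euler x - euler (p * x) = (\<Sum>j. euler_coeff p j * (1 - p ^ j) * x ^ j)"
    unfolding euler_def suminf_diff[OF euler_summable' euler_summable']
    by (simp add: power_mult_distrib algebra_simps)
  also have "\<dots> = (\<Sum>j. euler_coeff p (Suc j) * (1 - p ^ Suc j) * x ^ j) * x"
  proof -
    have "summable (\<lambda>j. euler_coeff p j * (1 - p ^ j) * x ^ j)"
      using summable_diff[OF euler_summable'[of x] euler_summable'[of "p * x"]]
      by (simp add: power_mult_distrib algebra_simps)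
    from powser_split_head(1)[OF this] show ?thesis by simp
  qed
  also have "(\<lambda>j. euler_coeff p (Suc j) * (1 - p ^ Suc j) * x ^ j) =
      (\<lambda>j. - (euler_coeff p j * (p * x) ^ j))"
    using power_Suc_neq_1 by (simp add: fun_eq_iff euler_coeff_Suc power_mult_distrib)
  also have "suminf \<dots> * x = - x * euler (p * x)"
    unfolding euler_def by (simp add: suminf_minus[OF euler_summable'])
  finally show ?thesis by (simp add: algebra_simps)
qed

lemma euler_poch: "euler x = poch x p n * euler (x * p ^ n)"
proof (induction n)
  case (Suc n)
  then show ?case
    using euler_step[of "x * p ^ n"] by (simp add: poch_Suc mult_ac)
qed simp

lemma euler_tendsto_1: "(\<lambda>n. euler (x * p ^ n)) \<longlonglongrightarrow> 1"
proof -
  have "isCont euler 0"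
    unfolding euler_def[abs_def] by (rule isCont_powser_converges_everywhere) (rule euler_summable')
  moreover have "(\<lambda>n. x * p ^ n) \<longlonglongrightarrow> 0"
    using tendsto_mult_right_zero[OF power_tendsto_0] by simp
  ultimately have "(\<lambda>n. euler (x * p ^ n)) \<longlonglongrightarrow> euler 0"
    by (rule isCont_tendsto_compose)
  then show ?thesis by (simp add: euler_def)
qed

text \<open>Far along \<open>x * p ^ n\<close> the value is close to 1, and the finite product
  leading back to \<open>x\<close> is positive for \<open>x < 1\<close>.\<close>

lemma euler_nonzero:
  assumes "x < 1"
  shows "euler x \<noteq> 0"
proof -
  obtain n where "euler (x * p ^ n) > 0"
    using order_tendstoD(1)[OF euler_tendsto_1, of 0 x] by (auto simp: eventually_sequentially)
  then show ?thesis
    using euler_poch[of x n] poch_pos[OF p assms, of n] by simp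
qed

text \<open>The finite products are \<open>euler x / euler (x * p ^ n)\<close> with denominators
  tending to 1. The identity is claimed only eventually, because early denominators can be
  0.\<close>

lemma qpoch_inf_eq_euler: "qpoch_inf (of_real x) p = of_real (euler x)"
proof -
  have "(\<lambda>n. euler x / euler (x * p ^ n)) \<longlonglongrightarrow> euler x / 1"
    by (intro tendsto_intros euler_tendsto_1) simp
  moreover have "eventually (\<lambda>n. euler x / euler (x * p ^ n) = poch x p n) sequentially"
    using order_tendstoD(1)[OF euler_tendsto_1[of x] zero_less_one]
    by eventually_elim (use euler_poch in \<open>auto simp: field_simps\<close>)
  ultimately have "poch x p \<longlonglongrightarrow> euler x"
    by (simp add: tendsto_cong)
  then have "(\<lambda>n. complex_of_real (poch x p n)) \<longlonglongrightarrow> of_real (euler x)"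
    by (rule tendsto_of_real)
  then show ?thesis
    unfolding qpoch_inf_def qpoch_of_real by (rule limI)
qed

text \<open>The points \<open>p^(-m)\<close> with \<open>m \<ge> 0\<close> are zeros of
  \<open>(x;p)_inf\<close>. This cut-off makes the second sequence in the kernel one-sided.\<close>

lemma euler_powi:
  "euler (p powi (1 + k)) = (if 0 \<le> k then euler p / poch p p (nat k) else 0)"
proof (cases "0 \<le> k")
  case True
  have "p powi (1 + k) = p * p ^ nat k"
    using True by (simp add: power_int_def nat_add_distrib)
  then show ?thesis
    using euler_poch[of p "nat k"] poch_pos[OF p p(2), of "nat k"] True by simp
next
  case False
  define m where "m = nat (- (1 + k))"
  have "1 + k = - int m" using False by (simp add: m_def)
  then have "p powi (1 + k) * p ^ m = 1" using p by (simp add: power_int_minus)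
  \<comment> \<open>The vanishing factor has index \<open>m\<close>, so \<open>Suc m\<close> factors
    are taken.\<close>
  then have "poch (p powi (1 + k)) p (Suc m) = 0"
    by (simp add: poch_Suc)
  with euler_poch[of "p powi (1 + k)" "Suc m"] False show ?thesis by simp
qed

lemma euler_abs_summable: "(\<lambda>j. euler_coeff p j * x ^ j) abs_summable_on UNIV"
  using euler_summable[of x] by (simp add: summable_on_UNIV_nonneg_real_iff)

lemma euler_infsum: "(\<Sum>\<^sub>\<infinity>j. euler_coeff p j * x ^ j) = euler x"
  unfolding euler_def
  by (rule infsumI, rule norm_summable_imp_has_sum) (use euler_summable euler_summable' in auto)

text \<open>The left-hand side of the identity is \<open>(w;p)\<^sub>\<infinity>\<close> times the basic hypergeometric series
  \<open>\<^sub>1\<phi>\<^sub>1(0; w; p, z)\<close>, which is symmetric in \<open>w\<close> and \<open>z\<close>: expanding \<open>(w p\<^sup>i;p)\<^sub>\<infinity>\<close> turns it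
  into the double series with terms \<open>e\<^sub>i e\<^sub>j z\<^sup>i w\<^sup>j p\<^bsup>ij\<^esup>\<close>.\<close>

lemma phi11_symmetric:
  assumes w: "w < 1"
  shows "(\<lambda>i. euler_coeff p i * z ^ i / poch w p i) summable_on UNIV"
    and "euler w * (\<Sum>i. euler_coeff p i * z ^ i / poch w p i) =
         (\<Sum>\<^sub>\<infinity>j. euler_coeff p j * w ^ j * euler (z * p ^ j))"
proof -
  define t where "t = (\<lambda>i j. (euler_coeff p i * z ^ i) * (euler_coeff p j * w ^ j) * p ^ (i * j))"
  \<comment> \<open>The coupling factor \<open>p^(ij)\<close> is at most 1, so the product of two
    Euler series dominates the double series.\<close>
  have "(\<lambda>x. (case x of (i, j) \<Rightarrow> (euler_coeff p i * z ^ i) * (euler_coeff p j * w ^ j)) *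
      p ^ (fst x * snd x)) abs_summable_on UNIV"
  proof (rule abs_summable_on_mult_bounded[where M = 1])
    show "(\<lambda>(i, j). (euler_coeff p i * z ^ i) * (euler_coeff p j * w ^ j)) abs_summable_on UNIV"
      using abs_summable_on_times[OF euler_abs_summable[of z] euler_abs_summable[of w]] by simp
    show "norm (p ^ (fst x * snd x)) \<le> 1" for x
      using p by (simp add: power_le_one)
  qed
  from abs_summable_summable[OF this] have t_sum: "(\<lambda>(i, j). t i j) summable_on UNIV \<times> UNIV"
    by (simp add: t_def case_prod_unfold)
  have row: "(\<Sum>\<^sub>\<infinity>j. t i j) = euler w * (euler_coeff p i * z ^ i / poch w p i)" for i
  proof -
    have "(\<Sum>\<^sub>\<infinity>j. t i j) = (\<Sum>\<^sub>\<infinity>j. (euler_coeff p i * z ^ i) * (euler_coeff p j * (w * p ^ i) ^ j))"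
      by (simp add: t_def power_mult_distrib power_mult mult_ac)
    also have "\<dots> = euler_coeff p i * z ^ i * euler (w * p ^ i)"
      by (simp only: infsum_cmult_right' euler_infsum)
    finally show ?thesis
      using euler_poch[of w i] poch_pos[OF p w, of i] by simp
  qed
  have col: "(\<Sum>\<^sub>\<infinity>i. t i j) = euler_coeff p j * w ^ j * euler (z * p ^ j)" for j
  proof -
    have "p ^ (i * j) = (p ^ j) ^ i" for i by (simp add: mult.commute flip: power_mult)
    then have "(\<Sum>\<^sub>\<infinity>i. t i j) = (\<Sum>\<^sub>\<infinity>i. (euler_coeff p j * w ^ j) * (euler_coeff p i * (z * p ^ j) ^ i))"
      by (simp add: t_def power_mult_distrib mult_ac)
    then show ?thesis
      by (simp only: infsum_cmult_right' euler_infsum)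
  qed
  have rows_sum: "(\<lambda>i. euler w * (euler_coeff p i * z ^ i / poch w p i)) summable_on UNIV"
    using summable_on_Sigma_banach[OF t_sum] by (simp only: row)
  then have "(\<lambda>i. inverse (euler w) * (euler w * (euler_coeff p i * z ^ i / poch w p i))) summable_on UNIV"
    by (rule summable_on_cmult_right)
  then show sum: "(\<lambda>i. euler_coeff p i * z ^ i / poch w p i) summable_on UNIV"
    using euler_nonzero[OF w] by (simp flip: mult.assoc)
  have "(\<Sum>i. euler_coeff p i * z ^ i / poch w p i) = (\<Sum>\<^sub>\<infinity>i. euler_coeff p i * z ^ i / poch w p i)"
    using has_sum_imp_sums[OF has_sum_infsum[OF sum]] sums_unique by metis
  then have "euler w * (\<Sum>i. euler_coeff p i * z ^ i / poch w p i) = (\<Sum>\<^sub>\<infinity>i. \<Sum>\<^sub>\<infinity>j. t i j)"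
    by (simp only: row infsum_cmult_right')
  also have "\<dots> = (\<Sum>\<^sub>\<infinity>j. \<Sum>\<^sub>\<infinity>i. t i j)"
    by (rule infsum_swap_banach) (rule t_sum)
  finally show "euler w * (\<Sum>i. euler_coeff p i * z ^ i / poch w p i) =
         (\<Sum>\<^sub>\<infinity>j. euler_coeff p j * w ^ j * euler (z * p ^ j))"
    by (simp only: col)
qed

text \<open>\<open>(x;p)\<^sub>\<infinity>\<close> and \<open>\<Sum>\<^sub>m x\<^sup>m / (p;p)\<^sub>m\<close> are inverse power series.\<close>

lemma euler_coeff_convolution:
  "(\<Sum>j\<le>N. euler_coeff p j / poch p p (N - j)) = (if N = 0 then 1 else 0)"
proof (cases N)
  case (Suc M)
  define S where "S = (\<Sum>j\<le>M. p ^ j * euler_coeff p j / poch p p (M - j))"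
  \<comment> \<open>With \<open>A = p^j\<close> and \<open>B = p^(M+1-j)\<close>, the split
    \<open>1 - AB = (1 - A) + A (1 - B)\<close> yields two sums that cancel. The first loses its
    term \<open>j = 0\<close> and shifts by the recurrence of \<open>euler_coeff\<close>; the second
    loses its term \<open>j = M + 1\<close>.\<close>
  have "(1 - p ^ Suc M) * (\<Sum>j\<le>Suc M. euler_coeff p j / poch p p (Suc M - j)) =
      (\<Sum>j\<le>Suc M. (1 - p ^ j) * euler_coeff p j / poch p p (Suc M - j)) +
      (\<Sum>j\<le>Suc M. p ^ j * euler_coeff p j * ((1 - p ^ (Suc M - j)) / poch p p (Suc M - j)))"
    unfolding sum_distrib_left sum.distrib[symmetric]
  proof (rule sum.cong[OF refl])
    fix j assume "j \<in> {..Suc M}"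
    then have "p ^ Suc M = p ^ j * p ^ (Suc M - j)"
      by (simp only: atMost_iff flip: power_add) simp
    moreover have "(1 - A * B) * (e / c) = (1 - A) * e / c + A * e * ((1 - B) / c)"
      for A B c e :: real
      by (simp add: diff_divide_distrib algebra_simps)
    ultimately show "(1 - p ^ Suc M) * (euler_coeff p j / poch p p (Suc M - j)) =
      (1 - p ^ j) * euler_coeff p j / poch p p (Suc M - j) +
      p ^ j * euler_coeff p j * ((1 - p ^ (Suc M - j)) / poch p p (Suc M - j))"
      by (simp only:)
  qed
  also have "(\<Sum>j\<le>Suc M. (1 - p ^ j) * euler_coeff p j / poch p p (Suc M - j)) = - S"
  proof -
    have "(1 - p ^ Suc j) * euler_coeff p (Suc j) = - (p ^ j * euler_coeff p j)" for j
      using power_Suc_neq_1 by (simp add: euler_coeff_Suc)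
    then show ?thesis
      unfolding sum.atMost_Suc_shift S_def by (simp add: sum_negf del: power_Suc)
  qed
  also have "(\<Sum>j\<le>Suc M. p ^ j * euler_coeff p j * ((1 - p ^ (Suc M - j)) / poch p p (Suc M - j))) = S"
  proof -
    have "(1 - p ^ (Suc M - j)) / poch p p (Suc M - j) = 1 / poch p p (M - j)" if "j \<le> M" for j
      using that power_Suc_neq_1 by (simp add: Suc_diff_le poch_Suc)
    then show ?thesis
      unfolding sum.atMost_Suc S_def by simp
  qed
  finally show ?thesis
    using power_Suc_neq_1 Suc by (simp del: power_Suc)
qed simp

end

section \<open>The kernel as a correlation of inverse sequences\<close>

definition extend_nat :: "(nat \<Rightarrow> real) \<Rightarrow> int \<Rightarrow> real" where
  "extend_nat f n = (if 0 \<le> n then f (nat n) else 0)"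

lemma extend_nat_int [simp]: "extend_nat f (int j) = f j"
  by (simp add: extend_nat_def)

lemma extend_nat_abs_summable:
  assumes "f abs_summable_on UNIV"
  shows "extend_nat f abs_summable_on UNIV"
proof -
  have "((\<lambda>n. norm (extend_nat f n)) \<circ> int) summable_on UNIV"
    using assms by (simp add: o_def)
  then have "(\<lambda>n. norm (extend_nat f n)) summable_on range int"
    by (subst summable_on_reindex) simp_all
  then show ?thesis
  proof (rule summable_on_cong_neutral[THEN iffD1, rotated -1])
    show "norm (extend_nat f n) = 0" if "n \<in> UNIV - range int" for n
    proof -
      have "\<not> 0 \<le> n" using that nonneg_int_cases by blast
      then show ?thesis by (simp add: extend_nat_def)
    qed
  qed auto
qed

lemma infsum_extend_nat_mult:
  "(\<Sum>\<^sub>\<infinity>n. extend_nat f n * g n) = (\<Sum>\<^sub>\<infinity>j. f j * g (int j))"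
proof -
  have "(\<Sum>\<^sub>\<infinity>n. extend_nat f n * g n) = infsum (\<lambda>n. extend_nat f n * g n) (range int)"
  proof (rule infsum_cong_neutral)
    show "extend_nat f n * g n = 0" if "n \<in> UNIV - range int" for n
    proof -
      have "\<not> 0 \<le> n" using that nonneg_int_cases by blast
      then show ?thesis by (simp add: extend_nat_def)
    qed
  qed auto
  also have "\<dots> = (\<Sum>\<^sub>\<infinity>j. f j * g (int j))"
    by (subst infsum_reindex) (simp_all add: o_def)
  finally show ?thesis .
qed

text \<open>Index \<open>k\<close> is the exponent of \<open>s\<close> in
  \<open>(r/s;p)_inf / (r s;p)_inf\<close>: the first sequence expands the numerator, the second the
  reciprocal of the denominator.\<close>

definition qkernel :: "real \<Rightarrow> real \<Rightarrow> int \<Rightarrow> real" where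
  "qkernel p r = correlation (extend_nat (\<lambda>j. euler_coeff p j * r ^ j))
                             (extend_nat (\<lambda>m. r ^ m / poch p p m))"

context
  fixes p r :: real
  assumes p: "0 < p" "p < 1" and r: "0 < r" "r < 1"
begin

lemma qkernel_factors_abs_summable:
  "extend_nat (\<lambda>j. euler_coeff p j * r ^ j) abs_summable_on UNIV"
  "extend_nat (\<lambda>m. r ^ m / poch p p m) abs_summable_on UNIV"
proof -
  have "(\<lambda>m. r ^ m / poch p p m) abs_summable_on UNIV"
    using inverse_poch_summable[OF p, of r] r by (simp add: summable_on_UNIV_nonneg_real_iff)
  then show "extend_nat (\<lambda>m. r ^ m / poch p p m) abs_summable_on UNIV"
    by (rule extend_nat_abs_summable)
qed (rule extend_nat_abs_summable, rule euler_abs_summable[OF p])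

lemma qkernel_abs_summable: "qkernel p r abs_summable_on UNIV"
  unfolding qkernel_def by (rule correlation_abs_summable) (rule qkernel_factors_abs_summable)+

text \<open>In the convolution of the two sequences the powers of \<open>r\<close> combine to the
  constant \<open>r^N\<close>, which leaves \<open>euler_coeff_convolution\<close>.\<close>

lemma qkernel_orthogonal:
  "(\<Sum>\<^sub>\<infinity>k. qkernel p r k * qkernel p r (k + n)) = (if n = 0 then 1 else 0)"
  unfolding qkernel_def
proof (rule correlation_orthogonal)
  fix n
  have "(\<Sum>\<^sub>\<infinity>j. extend_nat (\<lambda>j. euler_coeff p j * r ^ j) j * extend_nat (\<lambda>m. r ^ m / poch p p m) (n - j)) =
      (\<Sum>\<^sub>\<infinity>j. euler_coeff p j * r ^ j * extend_nat (\<lambda>m. r ^ m / poch p p m) (n - int j))"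
    by (rule infsum_extend_nat_mult)
  also have "\<dots> = (if n = 0 then 1 else 0)"
  proof (cases "0 \<le> n")
    case True
    then obtain N where N: "n = int N" by (rule nonneg_int_cases)
    have "(\<Sum>\<^sub>\<infinity>j. euler_coeff p j * r ^ j * extend_nat (\<lambda>m. r ^ m / poch p p m) (n - int j)) =
        infsum (\<lambda>j. r ^ N * (euler_coeff p j / poch p p (N - j))) {..N}"
    proof (rule infsum_cong_neutral)
      fix j assume "j \<in> UNIV \<inter> {..N}"
      then have "j \<le> N" by simp
      then have "n - int j = int (N - j)" "r ^ N = r ^ j * r ^ (N - j)"
        by (simp_all add: N flip: power_add)
      then show "euler_coeff p j * r ^ j * extend_nat (\<lambda>m. r ^ m / poch p p m) (n - int j) =
          r ^ N * (euler_coeff p j / poch p p (N - j))"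
        by simp
    qed (auto simp: N extend_nat_def)
    also have "\<dots> = r ^ N * (\<Sum>j\<le>N. euler_coeff p j / poch p p (N - j))"
      by (simp add: sum_distrib_left)
    finally show ?thesis
      by (simp add: euler_coeff_convolution[OF p] N)
  qed (simp add: extend_nat_def)
  finally show "(\<Sum>\<^sub>\<infinity>j. extend_nat (\<lambda>j. euler_coeff p j * r ^ j) j *
      extend_nat (\<lambda>m. r ^ m / poch p p m) (n - j)) = (if n = 0 then 1 else 0)" .
qed (rule qkernel_factors_abs_summable)+

text \<open>This is \<open>phi11_symmetric\<close> at \<open>w = r^2\<close>,
  \<open>z = p^(1+k)\<close>. By \<open>euler_powi\<close> the factors
  \<open>euler p (z * p ^ j)\<close> become reciprocals of \<open>poch p p (k + j)\<close> or 0, and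
  \<open>r^k r^(2j) = r^j r^(k+j)\<close> splits the powers between the two sequences.\<close>

lemma qkernel_eq_phi11:
  "qkernel p r k = euler p (r\<^sup>2) / euler p p *
     (r powi k * (\<Sum>i. euler_coeff p i * (p powi (1 + k)) ^ i / poch (r\<^sup>2) p i))"
proof -
  have r2: "r\<^sup>2 < 1"
    using r by (simp add: power_less_one_iff)
  have Ep: "euler p p \<noteq> 0"
    using p by (intro euler_nonzero) auto
  have "euler p (r\<^sup>2) * (\<Sum>i. euler_coeff p i * (p powi (1 + k)) ^ i / poch (r\<^sup>2) p i) =
      (\<Sum>\<^sub>\<infinity>j. euler_coeff p j * (r\<^sup>2) ^ j * euler p (p powi (1 + k) * p ^ j))"
    by (rule phi11_symmetric(2)[OF p r2])
  moreover have "r powi k / euler p p * (euler_coeff p j * (r\<^sup>2) ^ j * euler p (p powi (1 + k) * p ^ j)) =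
      euler_coeff p j * r ^ j * extend_nat (\<lambda>m. r ^ m / poch p p m) (k + int j)" for j
  proof -
    have "p powi (1 + k) * p ^ j = p powi (1 + (k + int j))"
      using p by (simp add: power_int_add)
    moreover have "r powi k * r ^ j = r ^ nat (k + int j)" if "0 \<le> k + int j"
    proof -
      have "r powi k * r ^ j = r powi (k + int j)"
        using r by (simp add: power_int_add)
      with that show ?thesis by (simp add: power_int_def)
    qed
    ultimately show ?thesis
      using Ep by (simp add: euler_powi[OF p] extend_nat_def power2_eq_square power_mult_distrib mult_ac)
  qed
  ultimately have "(\<Sum>\<^sub>\<infinity>j. euler_coeff p j * r ^ j * extend_nat (\<lambda>m. r ^ m / poch p p m) (k + int j)) =
      r powi k / euler p p * (euler p (r\<^sup>2) * (\<Sum>i. euler_coeff p i * (p powi (1 + k)) ^ i / poch (r\<^sup>2) p i))"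
    by (simp only: infsum_cmult_right'[symmetric])
  then show ?thesis
    by (simp add: qkernel_def correlation_def infsum_extend_nat_mult mult_ac)
qed

end

section \<open>The cosine and sine as kernels\<close>

lemma poch_even: "poch q q (2 * i) = poch q (q\<^sup>2) i * poch (q\<^sup>2) (q\<^sup>2) i"
  by (induction i) (simp_all add: poch_Suc power_mult power_mult_distrib power2_eq_square mult_ac)

text \<open>The factors \<open>1 - q^m\<close> are sorted by the parity of \<open>m\<close>; with
  \<open>m = 1\<close> split off, the odd exponents start at 3.\<close>

lemma poch_odd: "poch q q (2 * i + 1) = (1 - q) * (poch (q ^ 3) (q\<^sup>2) i * poch (q\<^sup>2) (q\<^sup>2) i)"
  by (induction i) (simp_all add: poch_Suc power_mult power_mult_distrib power2_eq_square power3_eq_cube mult_ac)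

definition qratio :: "real \<Rightarrow> real" where
  "qratio q = euler (q\<^sup>2) q / euler (q\<^sup>2) (q\<^sup>2)"

context
  fixes q :: real
  assumes q: "0 < q" "q < 1"
begin

lemma q2: "0 < q\<^sup>2" "q\<^sup>2 < 1"
  using q by (auto simp: power_less_one_iff)

lemma q3: "q ^ 3 < 1"
  using q by (simp add: power_less_one_iff)

lemma qpoch_inf_ratio:
  "qpoch_inf (of_real q) (q\<^sup>2) / qpoch_inf (of_real (q\<^sup>2)) (q\<^sup>2) = of_real (qratio q)"
  by (simp only: qpoch_inf_eq_euler[OF q2] qratio_def of_real_divide)

lemma qratio_nonzero: "qratio q \<noteq> 0"
  unfolding qratio_def using euler_nonzero[OF q2] q q2 by simp

lemma phi11_argument: "euler_coeff (q\<^sup>2) i * (q\<^sup>2 * x\<^sup>2) ^ i =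
    (-1) ^ i * q ^ (i * (i + 1)) * x ^ (2 * i) / poch (q\<^sup>2) (q\<^sup>2) i"
proof -
  have "euler_coeff (q\<^sup>2) i * (q\<^sup>2 * x\<^sup>2) ^ i = (euler_coeff (q\<^sup>2) i * q ^ (2 * i)) * x ^ (2 * i)"
    by (simp add: power_mult_distrib power_mult)
  then show ?thesis by (simp add: euler_coeff_closed)
qed

text \<open>By \<open>poch_even\<close> the cosine is the series 1phi1 with lower parameter
  \<open>q\<close>, base \<open>q^2\<close> and argument \<open>q^2 x^2\<close>.\<close>

lemma qcos_of_real:
  "qcos q (of_real x) = of_real (\<Sum>i. euler_coeff (q\<^sup>2) i * (q\<^sup>2 * x\<^sup>2) ^ i / poch q (q\<^sup>2) i)"
proof -
  have sum: "summable (\<lambda>i. euler_coeff (q\<^sup>2) i * (q\<^sup>2 * x\<^sup>2) ^ i / poch q (q\<^sup>2) i)"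
    by (rule summable_on_imp_summable, rule phi11_symmetric(1)[OF q2 q(2)])
  have "qcos q (of_real x) =
      (\<Sum>i. complex_of_real (euler_coeff (q\<^sup>2) i * (q\<^sup>2 * x\<^sup>2) ^ i / poch q (q\<^sup>2) i))"
    unfolding qcos_def phi11_argument qpoch_of_real poch_even by (simp add: mult_ac)
  then show ?thesis
    by (simp only: suminf_of_real[OF sum])
qed

lemma qsin_of_real:
  "qsin q (of_real x) =
     of_real (x / (1 - q) * (\<Sum>i. euler_coeff (q\<^sup>2) i * (q\<^sup>2 * x\<^sup>2) ^ i / poch (q ^ 3) (q\<^sup>2) i))"
proof -
  have sum: "summable (\<lambda>i. euler_coeff (q\<^sup>2) i * (q\<^sup>2 * x\<^sup>2) ^ i / poch (q ^ 3) (q\<^sup>2) i)"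
    by (rule summable_on_imp_summable, rule phi11_symmetric(1)[OF q2 q3])
  have "qsin q (of_real x) =
      (\<Sum>i. complex_of_real (x / (1 - q) * (euler_coeff (q\<^sup>2) i * (q\<^sup>2 * x\<^sup>2) ^ i / poch (q ^ 3) (q\<^sup>2) i)))"
    unfolding qsin_def phi11_argument qpoch_of_real poch_odd by (simp add: mult_ac)
  also have "\<dots> = of_real (\<Sum>i. x / (1 - q) * (euler_coeff (q\<^sup>2) i * (q\<^sup>2 * x\<^sup>2) ^ i / poch (q ^ 3) (q\<^sup>2) i))"
    by (rule suminf_of_real[symmetric], rule summable_mult, rule sum)
  finally show ?thesis
    by (simp only: suminf_mult[OF sum])
qed

lemma powi_argument: "q\<^sup>2 * (q powi k)\<^sup>2 = (q\<^sup>2) powi (1 + k)"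
  using q by (simp add: power_int_add power_int_mult_distrib power2_eq_square)

lemma sqrt_powi: "sqrt q powi k * sqrt q powi k = q powi k"
  using q by (simp flip: power_int_mult_distrib)

lemma qratio_qcos:
  "of_real (qratio q * sqrt q powi k) * qcos q (of_real (q powi k)) = of_real (qkernel (q\<^sup>2) (sqrt q) k)"
proof -
  have "qkernel (q\<^sup>2) (sqrt q) k = qratio q * sqrt q powi k *
      (\<Sum>i. euler_coeff (q\<^sup>2) i * (q\<^sup>2 * (q powi k)\<^sup>2) ^ i / poch q (q\<^sup>2) i)"
    using qkernel_eq_phi11[OF q2, of "sqrt q" k] q
    by (simp add: powi_argument qratio_def)
  then show ?thesis
    by (simp only: qcos_of_real of_real_mult)
qed

text \<open>Here \<open>r^2 = q^3\<close>. The extra \<open>q powi k\<close> in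
  \<open>r powi k\<close> is the leading \<open>z\<close> of the sine, and
  \<open>(q;q^2)_inf = (1 - q) (q^3;q^2)_inf\<close> supplies its denominator
  \<open>1 - q\<close>.\<close>

lemma qratio_qsin:
  "of_real (qratio q * sqrt q powi k) * qsin q (of_real (q powi k)) = of_real (qkernel (q\<^sup>2) (sqrt q ^ 3) k)"
proof -
  have r: "0 < sqrt q ^ 3" "sqrt q ^ 3 < 1"
    using q by (auto simp: power_less_one_iff)
  have r2: "(sqrt q ^ 3)\<^sup>2 = q ^ 3"
  proof -
    have "(sqrt q ^ 3)\<^sup>2 = ((sqrt q)\<^sup>2) ^ 3"
      by (simp only: mult.commute flip: power_mult)
    then show ?thesis using q by simp
  qed
  have "(sqrt q ^ 3) powi k = sqrt q powi k * q powi k"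
    using q by (simp add: power3_eq_cube power_int_mult_distrib sqrt_powi)
  moreover have "euler (q\<^sup>2) q = (1 - q) * euler (q\<^sup>2) (q ^ 3)"
    using euler_step[OF q2, of q] by (simp add: power3_eq_cube power2_eq_square mult_ac)
  ultimately have "qkernel (q\<^sup>2) (sqrt q ^ 3) k = qratio q * sqrt q powi k * (q powi k / (1 - q) *
      (\<Sum>i. euler_coeff (q\<^sup>2) i * (q\<^sup>2 * (q powi k)\<^sup>2) ^ i / poch (q ^ 3) (q\<^sup>2) i))"
    using qkernel_eq_phi11[OF q2 r, of k, unfolded r2] q
    by (simp add: powi_argument qratio_def)
  then show ?thesis
    by (simp only: qsin_of_real of_real_mult)
qed

text \<open>From here on \<open>T\<close> enters only through \<open>\<phi>\<close>, so that cosine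
  and sine are treated together.\<close>

lemma unitary_kernel:
  assumes "T = qcos q \<or> T = qsin q"
  obtains \<phi> where "\<phi> abs_summable_on UNIV"
    and "\<And>n. (\<Sum>\<^sub>\<infinity>k. \<phi> k * \<phi> (k + n)) = (if n = 0 then 1 else 0 :: real)"
    and "\<And>k. of_real (qratio q * sqrt q powi k) * T (of_real (q powi k)) = of_real (\<phi> k)"
proof (cases "T = qcos q")
  case True
  have "0 < sqrt q" "sqrt q < 1" using q by auto
  with True show ?thesis
    using that[of "qkernel (q\<^sup>2) (sqrt q)"] qkernel_abs_summable[OF q2] qkernel_orthogonal[OF q2]
      qratio_qcos by simp
next
  case False
  have "0 < sqrt q ^ 3" "sqrt q ^ 3 < 1" using q by (auto simp: power_less_one_iff)
  moreover have "T = qsin q" using False assms by simp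
  ultimately show ?thesis
    using that[of "qkernel (q\<^sup>2) (sqrt q ^ 3)"] qkernel_abs_summable[OF q2] qkernel_orthogonal[OF q2]
      qratio_qsin by simp
qed

end

section \<open>The transform on the lattice\<close>

context
  fixes q :: real and T :: "complex \<Rightarrow> complex" and \<phi> :: "int \<Rightarrow> real"
  assumes q: "0 < q" "q < 1"
    and \<phi>: "\<phi> abs_summable_on UNIV"
    and orth: "\<And>n. (\<Sum>\<^sub>\<infinity>k. \<phi> k * \<phi> (k + n)) = (if n = 0 then 1 else 0 :: real)"
    and T: "\<And>k. of_real (qratio q * sqrt q powi k) * T (of_real (q powi k)) = of_real (\<phi> k)"
begin

text \<open>This identifies the weighted space with square summable sequences on the
  integers.\<close>

definition rescale :: "(real \<Rightarrow> complex) \<Rightarrow> int \<Rightarrow> complex" where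
  "rescale f k = of_real (sqrt q powi k) * f (q powi k)"

lemma sqrt_powi_nonzero: "sqrt q powi k \<noteq> 0"
  using q by simp

lemma norm_rescale: "(norm (rescale f k))\<^sup>2 = q powi k * (norm (f (q powi k)))\<^sup>2"
proof -
  have "(sqrt q powi k)\<^sup>2 = q powi k"
    using sqrt_powi[OF q] by (simp add: power2_eq_square)
  then show ?thesis
    by (simp add: rescale_def norm_mult power_mult_distrib del: of_real_power_int)
qed

lemma rescale_summable:
  assumes "f \<in> qH q"
  shows "(\<lambda>k. (norm (rescale f k))\<^sup>2) summable_on UNIV"
  using assms by (simp add: norm_rescale qH_def)

lemma rescale_bounded:
  assumes "f \<in> qH q"
  obtains M where "\<And>k. norm (rescale f k) \<le> M"
proof -
  obtain M where "\<And>k. norm ((norm (rescale f k))\<^sup>2) \<le> M"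
    using abs_summable_on_bounded[of "\<lambda>k. (norm (rescale f k))\<^sup>2"] rescale_summable[OF assms] by auto
  then have "norm (rescale f k) \<le> sqrt M" for k
    by (simp add: real_le_rsqrt)
  then show ?thesis by (rule that)
qed

text \<open>The half powers balance: \<open>q^((k+n)/2) q^(k/2) = q^(n/2) q^k\<close>, so the
  rescaled kernel depends on \<open>k + n\<close> alone.\<close>

lemma kernel_term:
  "of_real (qratio q) * (of_real (q powi k) * T (of_real (q powi (k + n))) * f (q powi k)) =
     inverse (of_real (sqrt q powi n)) * (of_real (\<phi> (k + n)) * rescale f k)"
proof -
  have "of_real (\<phi> (k + n)) * rescale f k = of_real (qratio q) * T (of_real (q powi (k + n))) *
      f (q powi k) * of_real (sqrt q powi (k + n) * sqrt q powi k)"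
    unfolding T[symmetric] rescale_def by simp
  also have "sqrt q powi (k + n) * sqrt q powi k = sqrt q powi n * q powi k"
    using q by (simp add: power_int_add flip: sqrt_powi[OF q])
  finally show ?thesis
    using sqrt_powi_nonzero[of n] by (simp add: field_simps)
qed

lemma qtransform_terms_summable:
  assumes "f \<in> qH q"
  shows "(\<lambda>k. of_real (q powi k) * T (of_real (q powi (k + n))) * f (q powi k)) summable_on UNIV"
proof -
  obtain M where "\<And>k. norm (rescale f k) \<le> M"
    using rescale_bounded[OF assms] by blast
  from abs_summable_summable[OF hankel_terms_summable[OF \<phi> this, of n]]
  have "(\<lambda>k. inverse (of_real (qratio q)) * (inverse (of_real (sqrt q powi n)) *
      (of_real (\<phi> (k + n)) * rescale f k))) summable_on UNIV"
    by (intro summable_on_cmult_right)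
  then show ?thesis
    unfolding kernel_term[symmetric] using qratio_nonzero[OF q]
    by (simp flip: mult.assoc)
qed

lemma rescale_transform:
  "of_real (sqrt q powi n) * (of_real (qratio q) *
     (\<Sum>\<^sub>\<infinity>k. of_real (q powi k) * T (of_real (q powi (k + n))) * f (q powi k))) =
   hankel \<phi> (rescale f) n"
  unfolding infsum_cmult_right'[symmetric] kernel_term
  unfolding infsum_cmult_right' hankel_def
  using sqrt_powi_nonzero[of n] by simp

lemma transform_iff:
  "(\<forall>n. g (q powi n) = qpoch_inf (of_real q) (q\<^sup>2) / qpoch_inf (of_real (q\<^sup>2)) (q\<^sup>2) *
     (\<Sum>\<^sub>\<infinity>k. of_real (q powi k) * T (of_real (q powi (k + n))) * f (q powi k))) \<longleftrightarrow>
   rescale g = hankel \<phi> (rescale f)"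
  unfolding qpoch_inf_ratio[OF q] fun_eq_iff rescale_transform[symmetric] rescale_def
  using q by simp

lemma rescale_qtransform: "rescale (qtransform q T f) = hankel \<phi> (rescale f)"
  using transform_iff[of "qtransform q T f" f] qtransform_powi[OF q(1), of T f] by blast

lemma rescale_inject:
  assumes "\<And>x. x \<notin> qlattice q \<Longrightarrow> f x = g x" "rescale f = rescale g"
  shows "f = g"
proof
  fix x
  show "f x = g x"
  proof (cases "x \<in> qlattice q")
    case True
    then obtain k where "x = q powi k" by (auto simp: qlattice_def)
    then show ?thesis
      using fun_cong[OF assms(2), of k] q by (simp add: rescale_def)
  qed (rule assms(1))
qed

lemma hankel_hankel_rescale:
  assumes "f \<in> qH q"
  shows "hankel \<phi> (hankel \<phi> (rescale f)) = rescale f"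
proof -
  obtain M where "\<And>k. norm (rescale f k) \<le> M"
    using rescale_bounded[OF assms] by blast
  then show ?thesis
    by (intro ext hankel_hankel[OF \<phi> orth])
qed

lemma qtransform_parseval:
  assumes "f \<in> qH q"
  shows "((\<lambda>n. q powi n * (norm (qtransform q T f (q powi n)))\<^sup>2) has_sum
    (\<Sum>\<^sub>\<infinity>k. q powi k * (norm (f (q powi k)))\<^sup>2)) UNIV"
  using hankel_parseval[OF \<phi> orth rescale_summable[OF assms]]
  unfolding norm_rescale rescale_qtransform[symmetric] .

lemma qtransform_off_lattice: "x \<notin> qlattice q \<Longrightarrow> qtransform q T f x = 0"
  by (simp add: qtransform_def)

lemma qtransform_in_qH:
  assumes "f \<in> qH q"
  shows "qtransform q T f \<in> qH q"
  using qtransform_parseval[OF assms] by (auto simp: qH_def qtransform_def summable_on_def)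

lemma qtransform_involution:
  assumes "f \<in> qH q"
  shows "qtransform q T (qtransform q T f) = f"
proof (rule rescale_inject)
  show "rescale (qtransform q T (qtransform q T f)) = rescale f"
    by (simp only: rescale_qtransform hankel_hankel_rescale[OF assms])
  show "qtransform q T (qtransform q T f) x = f x" if "x \<notin> qlattice q" for x
    using assms that by (simp add: qtransform_off_lattice qH_def)
qed

lemma qtransform_add:
  assumes f: "f \<in> qH q" and g: "g \<in> qH q"
  shows "qtransform q T (\<lambda>x. f x + g x) = (\<lambda>x. qtransform q T f x + qtransform q T g x)"
proof
  fix x
  show "qtransform q T (\<lambda>x. f x + g x) x = qtransform q T f x + qtransform q T g x"
  proof (cases "x \<in> qlattice q")
    case True
    then obtain n where "x = q powi n" by (auto simp: qlattice_def)
    then show ?thesis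
      using infsum_add[OF qtransform_terms_summable[OF f, of n] qtransform_terms_summable[OF g, of n]]
      by (simp only: qtransform_powi[OF q(1)] distrib_left)
  qed (simp add: qtransform_off_lattice)
qed

lemma qtransform_scale: "qtransform q T (\<lambda>x. c * f x) = (\<lambda>x. c * qtransform q T f x)"
  by (rule ext) (simp add: qtransform_def mult.left_commute[of _ c] infsum_cmult_right')

lemma qtransform_isometry_onto: "qH_isometry_onto q (qtransform q T)"
  unfolding qH_isometry_onto_def
proof (intro conjI ballI allI)
  show "qtransform q T ` qH q = qH q"
    \<comment> \<open>An involution that maps \<open>qH q\<close> into itself is onto.\<close>
    using qtransform_in_qH qtransform_involution by (metis image_iff subsetI subset_antisym)
  show "qH_norm q (qtransform q T f) = qH_norm q f" if "f \<in> qH q" for f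
    using infsumI[OF qtransform_parseval[OF that]] by (simp add: qH_norm_def)
qed (simp_all only: qtransform_add qtransform_scale)

lemma transform_symmetric:
  assumes "f \<in> qH q" "g \<in> qH q"
  shows "rescale g = hankel \<phi> (rescale f) \<longleftrightarrow> rescale f = hankel \<phi> (rescale g)"
  using hankel_hankel_rescale assms by metis

lemma transform_norm:
  assumes "f \<in> qH q" "rescale g = hankel \<phi> (rescale f)"
  shows "(\<Sum>\<^sub>\<infinity>k. q powi k * (norm (f (q powi k)))\<^sup>2) = (\<Sum>\<^sub>\<infinity>n. q powi n * (norm (g (q powi n)))\<^sup>2)"
  using infsumI[OF hankel_parseval[OF \<phi> orth rescale_summable[OF assms(1)]]]
  unfolding assms(2)[symmetric] norm_rescale by (rule sym)

end

theorem mainTheorem5: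
  fixes q :: real and T :: "complex \<Rightarrow> complex"
  assumes "0 < q" and "q < 1"
    and "T = qcos q \<or> T = qsin q"
  shows
    "(\<forall>f\<in>qH q. \<forall>n::int.
        (\<lambda>k::int. of_real (q powi k) * T (of_real (q powi (k + n))) * f (q powi k)) summable_on UNIV)
     \<and> (\<forall>f\<in>qH q. \<forall>g\<in>qH q.
        (\<forall>n::int. g (q powi n) =
           qpoch_inf (of_real q) (q\<^sup>2) / qpoch_inf (of_real (q\<^sup>2)) (q\<^sup>2) *
           (\<Sum>\<^sub>\<infinity>k::int. of_real (q powi k) * T (of_real (q powi (k + n))) * f (q powi k)))
        \<longleftrightarrow>
        (\<forall>k::int. f (q powi k) =
           qpoch_inf (of_real q) (q\<^sup>2) / qpoch_inf (of_real (q\<^sup>2)) (q\<^sup>2) *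
           (\<Sum>\<^sub>\<infinity>n::int. of_real (q powi n) * T (of_real (q powi (k + n))) * g (q powi n))))
     \<and> qH_isometry_onto q (qtransform q T)
     \<and> (\<forall>f\<in>qH q. qtransform q T (qtransform q T f) = f)
     \<and> (\<forall>f\<in>qH q. \<forall>g\<in>qH q.
        (\<forall>n::int. g (q powi n) =
           qpoch_inf (of_real q) (q\<^sup>2) / qpoch_inf (of_real (q\<^sup>2)) (q\<^sup>2) *
           (\<Sum>\<^sub>\<infinity>k::int. of_real (q powi k) * T (of_real (q powi (k + n))) * f (q powi k)))
        \<longrightarrow>
        (\<Sum>\<^sub>\<infinity>k::int. q powi k * (cmod (f (q powi k)))\<^sup>2) =
        (\<Sum>\<^sub>\<infinity>n::int. q powi n * (cmod (g (q powi n)))\<^sup>2))"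
proof -
  note q = assms(1,2)
  obtain \<phi> where \<phi>: "\<phi> abs_summable_on UNIV"
      "\<And>n. (\<Sum>\<^sub>\<infinity>k. \<phi> k * \<phi> (k + n)) = (if n = 0 then 1 else 0 :: real)"
      "\<And>k. of_real (qratio q * sqrt q powi k) * T (of_real (q powi k)) = of_real (\<phi> k)"
    using unitary_kernel[OF q assms(3)] by blast
  note iff = transform_iff[OF q \<phi>]
  \<comment> \<open>The inverse formula is the forward one with the roles of \<open>f\<close> and
    \<open>g\<close> exchanged, once \<open>k + n\<close> is commuted.\<close>
  have iff': "(\<forall>k. f (q powi k) = qpoch_inf (of_real q) (q\<^sup>2) / qpoch_inf (of_real (q\<^sup>2)) (q\<^sup>2) *
      (\<Sum>\<^sub>\<infinity>n. of_real (q powi n) * T (of_real (q powi (k + n))) * g (q powi n))) \<longleftrightarrow>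
      rescale q f = hankel \<phi> (rescale q g)" for f g
    unfolding iff[symmetric] by (simp only: add.commute)
  show ?thesis
    unfolding iff iff'
    using qtransform_terms_summable[OF q \<phi>] transform_symmetric[OF q \<phi>]
      qtransform_isometry_onto[OF q \<phi>] qtransform_involution[OF q \<phi>] transform_norm[OF q \<phi>]
    by blast
qed

end
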